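(* Let $X$ be a finite set and let $b\in\mathcal{P}(X)$. The matrices, indexed by $\mathcal{P}(X)\times\mathcal{P}(X)$, of the partial orders $\leq_b$, $\dashv_b$ and $\sqsupset_b$, $$(G_b)_{p,p'}=\delta_{p'\leq_b p},\qquad (C_b)_{p,p'}=\delta_{p'\dashv_b p},\qquad (S_b)_{p,p'}=\delta_{p'\sqsupset_b p},$$ are linked by the equality $$G_b=C_bS_b .$$
   Context: $\mathcal{P}(X)$ is the set of partitions of $X$; $\mathrm{nc}(p)$ is the number of blocks of $p$; $p$ is finer than $p'$ (equivalently $p'$ is coarser than $p$) if every block of $p$ is contained in a block of $p'$; $p\vee p'$ is the finest partition coarser than both $p$ and $p'$. The distance on $\mathcal{P}(X)$ is $d(p,p')=\frac12(\mathrm{nc}(p)+\mathrm{nc}(p'))-\mathrm{nc}(p\vee p')$. For a base partition $b\in\mathcal{P}(X)$, the following partial orders are defined on $\mathcal{P}(X)$: - geodesic order: $p'\leq_b p$ if $d(b,p')+d(p',p)=d(b,p)$; - coarser-compatible order: $p'\dashv_b p$ if $p'$ is coarser than $p$ and $\mathrm{nc}(p'\vee b)=\mathrm{nc}(p\vee b)$; - finer-compatible order: $p'\sqsupset_b p$ if $p'$ is finer than $p$ and $\mathrm{nc}(p')-\mathrm{nc}(p'\vee b)=\mathrm{nc}(p)-\mathrm{nc}(p\vee b)$. $\delta_{A}$ equals $1$ if the condition $A$ holds and $0$ otherwise. The product of matrices is the usual one: $(C_bS_b)_{p,p'}=\sum_{p''\in\mathcal{P}(X)}(C_b)_{p,p''}(S_b)_{p'',p'}$.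 *)

theory Defs
  imports Complex_Main "HOL-Library.Disjoint_Sets"
begin

definition partitions :: "'a set \<Rightarrow> 'a set set set" where
  "partitions X = {p. partition_on X p}"

abbreviation nc :: "'a set set \<Rightarrow> nat" where
  "nc p \<equiv> card p"

(* "refines X p q" reads: p is finer than q, i.e. q is coarser than p. *)
definition part_join :: "'a set \<Rightarrow> 'a set set \<Rightarrow> 'a set set \<Rightarrow> 'a set set" where
  "part_join X p p' =
     (THE q. refines X p q \<and> refines X p' q \<and>
             (\<forall>r. refines X p r \<and> refines X p' r \<longrightarrow> refines X q r))"

(* The description in part_join_def is satisfied by exactly one partition. *)
lemma ex1_part_join:
  assumes "partition_on X p" and "partition_on X p'"
  shows "\<exists>!q. refines X p q \<and> refines X p' q \<and>
              (\<forall>r. refines X p r \<and> refines X p' r \<longrightarrow> refines X q r)"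
proof -
  let ?U = "{r. refines X p r \<and> refines X p' r}"
  have ne: "?U \<noteq> {}"
  proof (cases "X = {}")
    case True
    then have "p = {}" "p' = {}" using assms by (simp_all add: partition_on_empty)
    then have "{} \<in> ?U" using True by (simp add: refines_def partition_on_empty)
    then show ?thesis by blast
  next
    case False
    then have "{X} \<in> ?U"
      using assms by (auto simp: refines_def partition_on_space dest: partition_onD1)
    then show ?thesis by blast
  qed
  have part: "\<And>P. P \<in> ?U \<Longrightarrow> partition_on X P" by (simp add: refines_def)
  let ?q = "common_refinement ?U"
  have q: "refines X p ?q" "refines X p' ?q"
    by (rule common_refinement_coarsest[OF part]; use assms ne in blast)+
  have least: "refines X ?q r" if "refines X p r" "refines X p' r" for r
    by (rule refines_common_refinement[of ?U]) (simp_all add: part that)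
  show ?thesis
  proof (rule ex1I[of _ ?q], intro conjI allI impI)
    show "refines X p ?q" "refines X p' ?q" by (rule q)+
    show "refines X ?q r" if "refines X p r \<and> refines X p' r" for r
      by (rule least) (rule that[THEN conjunct1] that[THEN conjunct2])+
    show "r = ?q"
      if r: "refines X p r \<and> refines X p' r \<and>
             (\<forall>s. refines X p s \<and> refines X p' s \<longrightarrow> refines X r s)" for r
    proof (rule refines_asym)
      show "refines X r ?q"
        using r[THEN conjunct2, THEN conjunct2, THEN spec, of ?q] q by (rule mp[OF _ conjI])
      show "refines X ?q r"
        by (rule least) (rule r[THEN conjunct1] r[THEN conjunct2, THEN conjunct1])+
    qed
  qed
qed

lemma part_join:
  assumes "partition_on X p" and "partition_on X p'"
  shows "refines X p (part_join X p p')" "refines X p' (part_join X p p')"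
    "\<And>r. refines X p r \<Longrightarrow> refines X p' r \<Longrightarrow> refines X (part_join X p p') r"
  using theI'[OF ex1_part_join[OF assms], folded part_join_def] by simp_all

definition part_dist :: "'a set \<Rightarrow> 'a set set \<Rightarrow> 'a set set \<Rightarrow> real" where
  "part_dist X p p' = (real (nc p) + real (nc p')) / 2 - real (nc (part_join X p p'))"

(* In the three orders the arguments p', p come in the order of the infix notation,
   so e.g. geodesic_le X b p' p stands for p' \<le>\<^sub>b p. *)
definition geodesic_le :: "'a set \<Rightarrow> 'a set set \<Rightarrow> 'a set set \<Rightarrow> 'a set set \<Rightarrow> bool" where
  "geodesic_le X b p' p \<longleftrightarrow> partition_on X p' \<and> partition_on X p \<and>
     part_dist X b p' + part_dist X p' p = part_dist X b p"

definition coarser_compat :: "'a set \<Rightarrow> 'a set set \<Rightarrow> 'a set set \<Rightarrow> 'a set set \<Rightarrow> bool" where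
  "coarser_compat X b p' p \<longleftrightarrow> refines X p p' \<and>
     nc (part_join X p' b) = nc (part_join X p b)"

definition finer_compat :: "'a set \<Rightarrow> 'a set set \<Rightarrow> 'a set set \<Rightarrow> 'a set set \<Rightarrow> bool" where
  "finer_compat X b p' p \<longleftrightarrow> refines X p' p \<and>
     int (nc p') - int (nc (part_join X p' b)) = int (nc p) - int (nc (part_join X p b))"

(* Matrices with real entries indexed by I \<times> I are functions of a row and a column index;
   only the entries with both indices in I are meaningful. *)
type_synonym 'i matr = "'i \<Rightarrow> 'i \<Rightarrow> real"

definition matr_mult :: "'i set \<Rightarrow> 'i matr \<Rightarrow> 'i matr \<Rightarrow> 'i matr" where
  "matr_mult I A B = (\<lambda>i k. \<Sum>j\<in>I. A i j * B j k)"

(* Row index p, column index p': the column index is the smaller element. *)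
definition geodesic_matr :: "'a set \<Rightarrow> 'a set set \<Rightarrow> 'a set set matr" where
  "geodesic_matr X b = (\<lambda>p p'. of_bool (geodesic_le X b p' p))"

definition coarser_matr :: "'a set \<Rightarrow> 'a set set \<Rightarrow> 'a set set matr" where
  "coarser_matr X b = (\<lambda>p p'. of_bool (coarser_compat X b p' p))"

definition finer_matr :: "'a set \<Rightarrow> 'a set set \<Rightarrow> 'a set set matr" where
  "finer_matr X b = (\<lambda>p p'. of_bool (finer_compat X b p' p))"

end

theory Submission
  imports Defs
begin

text \<open>
  Write \<open>f p = nc p - nc (p \<or> b)\<close>. Then \<open>p' \<le>\<^sub>b p\<close> says \<open>f p' = nc (p \<or> p') - nc (p \<or> b)\<close>.
  The function \<open>f\<close> cannot increase when \<open>p\<close> becomes coarser, since merging two blocks of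
  \<open>p\<close> merges at most two blocks of \<open>p \<or> b\<close>. Hence, with \<open>q = p \<or> p'\<close>,
  \<open>f p' \<ge> f q \<ge> nc q - nc (p \<or> b)\<close>, and \<open>p' \<le>\<^sub>b p\<close> holds iff both inequalities are equalities,
  i.e. iff \<open>q\<close> is coarser-compatible below \<open>p\<close> and finer-compatible above \<open>p'\<close>. Any other
  intermediate partition is coarser than \<open>q\<close> and the same inequalities force it to have as many
  blocks as \<open>q\<close>.
\<close>

lemma refines_in_block:
  assumes "refines X p q" "A \<in> p"
  obtains A' where "A' \<in> q" "A \<subseteq> A'"
  using assms unfolding refines_def by blast

lemma part_block_ne:
  "partition_on X p \<Longrightarrow> A \<in> p \<Longrightarrow> A \<noteq> {}"
  using partition_onD3 by blast

lemma part_block_eq: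
  assumes "partition_on X p" "A \<in> p" "B \<in> p" "x \<in> A" "x \<in> B"
  shows "A = B"
  using assms partition_onD2[of X p] unfolding disjoint_def by blast

text \<open>The case \<open>A = B\<close> is allowed on purpose and leaves a partition containing
  \<open>A\<close> unchanged. Thus blocks of a join can be merged without knowing whether they
  differ.\<close>

definition merge_blocks :: "'a set \<Rightarrow> 'a set \<Rightarrow> 'a set set \<Rightarrow> 'a set set" where
  "merge_blocks A B p = insert (A \<union> B) (p - {A, B})"

lemma partition_on_merge_blocks:
  assumes "partition_on X p" "A \<in> p" "B \<in> p"
  shows "partition_on X (merge_blocks A B p)"
proof (rule partition_onI)
  show "\<Union> (merge_blocks A B p) = X"
    using partition_onD1[OF assms(1)] assms(2,3) by (auto simp: merge_blocks_def)
  show "{} \<notin> merge_blocks A B p"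
    using part_block_ne[OF assms(1)] assms(2,3) by (auto simp: merge_blocks_def)
  show "disjnt C D" if "C \<in> merge_blocks A B p" "D \<in> merge_blocks A B p" "C \<noteq> D" for C D
    using that part_block_eq[OF assms(1)] assms(2,3)
    unfolding merge_blocks_def disjnt_iff by blast
qed

lemma refines_merge_blocksI:
  assumes "partition_on X p" "refines X p q" "A \<in> q" "B \<in> q"
  shows "refines X p (merge_blocks A B q)"
proof -
  have "partition_on X q" using assms(2) by (simp add: refines_def)
  moreover have "\<exists>D\<in>merge_blocks A B q. C \<subseteq> D" if C: "C \<in> p" for C
  proof -
    obtain D where "D \<in> q" "C \<subseteq> D" using refines_in_block[OF assms(2) C] .
    then show ?thesis unfolding merge_blocks_def by blast
  qed
  ultimately show ?thesis
    using assms partition_on_merge_blocks unfolding refines_def by blast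
qed

lemma merge_blocks_refinesI:
  assumes "refines X p q" "A \<in> p" "B \<in> p" "C \<in> q" "A \<subseteq> C" "B \<subseteq> C"
  shows "refines X (merge_blocks A B p) q"
  using assms partition_on_merge_blocks[of X p A B]
  unfolding refines_def merge_blocks_def by auto

lemma card_merge_blocks:
  assumes "finite p" "partition_on X p" "A \<in> p" "B \<in> p"
  shows "Suc (card (merge_blocks A B p)) = card p + of_bool (A = B)"
proof (cases "A = B")
  case True
  then show ?thesis using assms by (simp add: merge_blocks_def insert_absorb)
next
  case False
  \<comment> \<open>Blocks are nonempty and disjoint, so a block equal to the union would meet,
    hence equal, both \<open>A\<close> and \<open>B\<close>.\<close>
  have "A \<union> B \<notin> p - {A, B}"
    using part_block_eq[OF assms(2)] part_block_ne[OF assms(2)] assms(3,4) by blast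
  then have "card (merge_blocks A B p) = Suc (card (p - {A, B}))"
    using assms(1) by (simp add: merge_blocks_def)
  moreover have "card {A, B} + card (p - {A, B}) = card p"
    using assms card_mono[of p "{A, B}"] by (simp add: card_Diff_subset)
  ultimately show ?thesis using False by simp
qed

text \<open>Supplies the induction step below: as long as \<open>p\<close> differs from
  \<open>q\<close>, two blocks of \<open>p\<close> can be merged with the result still finer than
  \<open>q\<close>.\<close>

lemma refines_neq_obtain:
  assumes "refines X p q" "p \<noteq> q"
  obtains A B C where "A \<in> p" "B \<in> p" "A \<noteq> B" "C \<in> q" "A \<subseteq> C" "B \<subseteq> C"
proof -
  have pq: "partition_on X p" "partition_on X q" using assms by (auto simp: refines_def)
  have "\<not> refines X q p" using assms refines_asym by blast
  then obtain C where C: "C \<in> q" "\<forall>A\<in>p. \<not> C \<subseteq> A" using pq unfolding refines_def by blast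
  \<comment> \<open>\<open>C\<close> is a union of blocks of \<open>p\<close>. As no single block
    covers it, a point of \<open>C\<close> outside the first block \<open>A\<close> yields the
    second.\<close>
  have sub: "A \<subseteq> C" if "A \<in> p" "x \<in> A" "x \<in> C" for A x
    using refines_in_block[OF assms(1) that(1)] part_block_eq[OF pq(2) C(1)] that by blast
  obtain x where x: "x \<in> C" using part_block_ne[OF pq(2) C(1)] by blast
  then obtain A where A: "A \<in> p" "x \<in> A"
    using C(1) partition_onD1[OF pq(1)] partition_onD1[OF pq(2)] by blast
  obtain y where y: "y \<in> C" "y \<notin> A" using C(2) A(1) by blast
  then obtain B where B: "B \<in> p" "y \<in> B"
    using C(1) partition_onD1[OF pq(1)] partition_onD1[OF pq(2)] by blast
  show thesis using that[of A B C] A B C(1) y sub[OF A x] sub[OF B y(1)] by blast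
qed

lemma card_refines_le:
  assumes "finite X" "refines X p q"
  shows "card q \<le> card p" "card q = card p \<Longrightarrow> p = q"
proof -
  have "card q \<le> card p \<and> (card q = card p \<longrightarrow> p = q)"
    using assms(2)
  proof (induction "card p" arbitrary: p rule: less_induct)
    case less
    show ?case
    proof (cases "p = q")
      case False
      from refines_neq_obtain[OF less.prems this] obtain A B C
        where ABC: "A \<in> p" "B \<in> p" "A \<noteq> B" "C \<in> q" "A \<subseteq> C" "B \<subseteq> C" .
      have p: "partition_on X p" using less.prems by (simp add: refines_def)
      have "Suc (card (merge_blocks A B p)) = card p"
        using card_merge_blocks[OF finite_elements[OF assms(1) p] p ABC(1,2)] ABC(3) by simp
      moreover have "refines X (merge_blocks A B p) q"
        by (rule merge_blocks_refinesI[OF less.prems]) (rule ABC)+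
      ultimately show ?thesis using less.hyps[of "merge_blocks A B p"] by linarith
    qed simp
  qed
  then show "card q \<le> card p" "card q = card p \<Longrightarrow> p = q" by blast+
qed

lemma partition_on_part_join:
  "partition_on X p \<Longrightarrow> partition_on X q \<Longrightarrow> partition_on X (part_join X p q)"
  using part_join(1) unfolding refines_def by blast

lemma part_join_commute: "part_join X p q = part_join X q p"
  unfolding part_join_def by (rule arg_cong[where f = The]) auto

lemma part_join_mono:
  assumes "refines X p q" "partition_on X b"
  shows "refines X (part_join X p b) (part_join X q b)"
proof -
  have pq: "partition_on X p" "partition_on X q" using assms(1) by (auto simp: refines_def)
  show ?thesis
    using part_join(3)[OF pq(1) assms(2)] part_join(1,2)[OF pq(2) assms(2)]
      refines_trans[OF assms(1)] by blast
qed

lemma card_part_join_antimono: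
  assumes "finite X" "refines X p q" "partition_on X b"
  shows "card (part_join X q b) \<le> card (part_join X p b)"
  by (rule card_refines_le[OF assms(1) part_join_mono[OF assms(2,3)]])

text \<open>Merging the blocks of the join that contain \<open>A\<close> and \<open>B\<close> gives
  a partition coarser than both \<open>b\<close> and the merged \<open>p\<close>, hence coarser than
  their join. This costs at most one block.\<close>

lemma card_part_join_merge_blocks:
  assumes "finite X" "partition_on X p" "partition_on X b" "A \<in> p" "B \<in> p"
  shows "card (part_join X p b) \<le> Suc (card (part_join X (merge_blocks A B p) b))"
proof -
  let ?r = "part_join X p b"
  have r: "refines X p ?r" "refines X b ?r" "partition_on X ?r"
    using part_join[OF assms(2,3)] partition_on_part_join[OF assms(2,3)] by auto
  obtain A' where A': "A' \<in> ?r" "A \<subseteq> A'" using refines_in_block[OF r(1) assms(4)] .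
  obtain B' where B': "B' \<in> ?r" "B \<subseteq> B'" using refines_in_block[OF r(1) assms(5)] .
  let ?r1 = "merge_blocks A' B' ?r"
  have "A' \<union> B' \<in> ?r1" by (simp add: merge_blocks_def)
  then have "refines X (merge_blocks A B p) ?r1"
    using merge_blocks_refinesI[OF refines_merge_blocksI[OF assms(2) r(1) A'(1) B'(1)] assms(4,5)]
      A' B' by blast
  moreover have "refines X b ?r1"
    by (rule refines_merge_blocksI[OF assms(3) r(2) A'(1) B'(1)])
  ultimately have "refines X (part_join X (merge_blocks A B p) b) ?r1"
    by (rule part_join(3)[OF partition_on_merge_blocks[OF assms(2,4,5)] assms(3)])
  then have "card ?r1 \<le> card (part_join X (merge_blocks A B p) b)"
    by (rule card_refines_le[OF assms(1)])
  then show ?thesis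
    using card_merge_blocks[OF finite_elements[OF assms(1) r(3)] r(3) A'(1) B'(1)] by linarith
qed

text \<open>Go from \<open>p\<close> to \<open>q\<close> by single merges: each lowers
  \<open>card p\<close> by exactly one and the number of blocks of the join with \<open>b\<close> by
  at most one. Sums replace differences to avoid truncated subtraction.\<close>

lemma card_part_join_submodular:
  assumes "finite X" "partition_on X b" "refines X p q"
  shows "card q + card (part_join X p b) \<le> card p + card (part_join X q b)"
  using assms(3)
proof (induction "card p" arbitrary: p rule: less_induct)
  case less
  show ?case
  proof (cases "p = q")
    case False
    from refines_neq_obtain[OF less.prems this] obtain A B C
      where ABC: "A \<in> p" "B \<in> p" "A \<noteq> B" "C \<in> q" "A \<subseteq> C" "B \<subseteq> C" .
    have p: "partition_on X p" using less.prems by (simp add: refines_def)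
    have "Suc (card (merge_blocks A B p)) = card p"
      using card_merge_blocks[OF finite_elements[OF assms(1) p] p ABC(1,2)] ABC(3) by simp
    moreover have "refines X (merge_blocks A B p) q"
      by (rule merge_blocks_refinesI[OF less.prems]) (rule ABC)+
    ultimately show ?thesis
      using less.hyps[of "merge_blocks A B p"]
        card_part_join_merge_blocks[OF assms(1) p assms(2) ABC(1,2)] by linarith
  qed simp
qed

lemma geodesic_le_iff:
  assumes "partition_on X p" "partition_on X p'"
  shows "geodesic_le X b p' p \<longleftrightarrow>
    card p' + card (part_join X p b) = card (part_join X p p') + card (part_join X p' b)"
proof -
  have "geodesic_le X b p' p \<longleftrightarrow>
    real (card p' + card (part_join X p b)) =
      real (card (part_join X p p') + card (part_join X p' b))"
    using assms part_join_commute[of X p' p] part_join_commute[of X b]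
    unfolding geodesic_le_def part_dist_def by (auto simp: field_simps)
  then show ?thesis by (simp only: of_nat_eq_iff)
qed

lemma coarser_finer_compat_iff:
  assumes "finite X" "partition_on X b" "partition_on X p" "partition_on X p'"
  shows "coarser_compat X b q p \<and> finer_compat X b p' q \<longleftrightarrow>
    q = part_join X p p' \<and> geodesic_le X b p' p"
proof -
  let ?q = "part_join X p p'"
  have pq: "refines X p ?q" and p'q: "refines X p' ?q"
    by (rule part_join[OF assms(3,4)])+
  note mono = card_part_join_antimono[OF assms(1) _ assms(2)]
  note submod = card_part_join_submodular[OF assms(1,2)]
  show ?thesis
  proof (intro iffI; elim conjE)
    assume cf: "coarser_compat X b q p" "finer_compat X b p' q"
    then have q: "refines X p q" "refines X p' q" by (auto simp: coarser_compat_def finer_compat_def)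
    then have qq: "refines X ?q q" by (rule part_join(3)[OF assms(3,4)])
    \<comment> \<open>Monotonicity squeezes the count of \<open>?q\<close> joined with
      \<open>b\<close> between two equal counts, those of \<open>p\<close> and \<open>q\<close>.
      Submodularity from \<open>p'\<close> to \<open>?q\<close> then gives \<open>card ?q\<close>
      \<le> \<open>card q\<close>; the converse holds because \<open>q\<close> is coarser.\<close>
    have "card q = card ?q"
      using card_refines_le(1)[OF assms(1) qq] mono[OF pq] mono[OF qq] submod[OF p'q] submod[OF qq] cf
      unfolding coarser_compat_def finer_compat_def by linarith
    then have q_eq: "q = ?q" using card_refines_le(2)[OF assms(1) qq] by simp
    moreover have "geodesic_le X b p' p"
      using cf
      unfolding geodesic_le_iff[OF assms(3,4)] q_eq[symmetric] coarser_compat_def finer_compat_def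
      by linarith
    ultimately show "q = ?q \<and> geodesic_le X b p' p" ..
  next
    assume "q = ?q" "geodesic_le X b p' p"
    then show "coarser_compat X b q p \<and> finer_compat X b p' q"
      using pq p'q mono[OF pq] submod[OF p'q]
      unfolding geodesic_le_iff[OF assms(3,4)] coarser_compat_def finer_compat_def by simp
  qed
qed

theorem theorem2p2:
  fixes X :: "'a set" and b :: "'a set set"
  assumes "finite X" and "b \<in> partitions X"
  shows "\<forall>p \<in> partitions X. \<forall>p' \<in> partitions X.
           geodesic_matr X b p p' =
             matr_mult (partitions X) (coarser_matr X b) (finer_matr X b) p p'"
proof (intro ballI)
  fix p p' assume "p \<in> partitions X" "p' \<in> partitions X"
  then have b: "partition_on X b" and p: "partition_on X p" "partition_on X p'"
    using assms(2) by (auto simp: partitions_def)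
  let ?q = "part_join X p p'" and ?g = "geodesic_le X b p' p"
  have "finite (partitions X)"
    using finitely_many_partition_on[OF assms(1)] by (simp add: partitions_def)
  moreover have "?q \<in> partitions X"
    using partition_on_part_join[OF p] by (simp add: partitions_def)
  \<comment> \<open>The only intermediate partition that can contribute is the join, so the sum over
    the finite set \<open>partitions X\<close> collapses to one term.\<close>
  moreover have "coarser_matr X b p q * finer_matr X b q p' = (if q = ?q then of_bool ?g else 0)"
    for q
    using coarser_finer_compat_iff[OF assms(1) b p, of q]
    by (auto simp: coarser_matr_def finer_matr_def)
  ultimately show "geodesic_matr X b p p' =
      matr_mult (partitions X) (coarser_matr X b) (finer_matr X b) p p'"
    by (simp add: matr_mult_def geodesic_matr_def)
qed

end
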